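(* Suppose $-1<\alpha<0$, $m\ge 0$ and $q<0$. Then the constrained variational problem $(P_0)$ has a global minimizer, and the global minimizers take (almost everywhere) the form $$\mathbf u=\mathbf a\,\chi_U+\mathbf b\,\chi_{\Omega\setminus U},$$ where $U\subset\Omega$ is a measurable set of size $$|U|=\frac12\left(1+\frac mn\right)|\Omega|$$ and $$\mathbf a=(\sqrt n,0,0),\qquad \mathbf b=(0,0,\sqrt n).$$
   Context: $\Omega\subset\mathbb R^3$ is a bounded domain with smooth boundary, $|\cdot|$ denotes Lebesgue measure, $\chi_S$ is the characteristic function of a set $S$, and $\mathbb R_+=[0,\infty)$. Real numbers $\alpha$, $q$, $N>0$, $M$ are given with $0\le M\le N$; put $n=N/|\Omega|$ and $m=M/|\Omega|$. A vector is written $\mathbf u=(u_1,u_0,u_{-1})\in\mathbb R_+^3$. The Thomas-Fermi Hamiltonian is $$H_{TF}(\mathbf u)=\tfrac12(u_1^2+u_0^2+u_{-1}^2)^2+\tfrac{\alpha}{2}\left[2u_0^2(u_1-\mathrm{sgn}(\alpha)u_{-1})^2+(u_1^2-u_{-1}^2)^2\right]+q(u_1^2+u_{-1}^2).$$ Problem $(P_0)$: minimize $\int_\Omega H_{TF}(\mathbf u(x))\,dx$ over all $\mathbf u\in (L^2(\Omega,\mathbb R_+))^3$ subject to $\int_\Omega (u_1^2+u_0^2+u_{-1}^2)\,dx=N$ and $\int_\Omega (u_1^2-u_{-1}^2)\,dx=M$. *)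

theory Defs
  imports "HOL-Analysis.Analysis"
begin

primrec Ck_on :: "nat \<Rightarrow> ('a::euclidean_space \<Rightarrow> real) \<Rightarrow> 'a set \<Rightarrow> bool" where
  "Ck_on 0 g W \<longleftrightarrow> continuous_on W g"
| "Ck_on (Suc k) g W \<longleftrightarrow> g differentiable_on W \<and>
     (\<forall>b\<in>Basis. Ck_on k (\<lambda>x. frechet_derivative g (at x) b) W)"

text \<open>Meant for open \<open>W\<close> only: the partial derivatives are taken with respect to the
  full neighbourhood filter.\<close>

definition Cinf_on :: "('a::euclidean_space \<Rightarrow> real) \<Rightarrow> 'a set \<Rightarrow> bool" where
  "Cinf_on g W \<longleftrightarrow> (\<forall>k. Ck_on k g W)"

text \<open>Smoothness of the boundary is expressed by local defining functions: near each boundary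
  point \<open>\<Omega>\<close> is the strict sublevel set of a smooth function without critical points, so that
  the boundary is locally its zero set and \<open>\<Omega>\<close> lies on one side of it.\<close>

definition smooth_boundary :: "'a::euclidean_space set \<Rightarrow> bool" where
  "smooth_boundary \<Omega> \<longleftrightarrow>
     (\<forall>p\<in>frontier \<Omega>. \<exists>W g. open W \<and> p \<in> W \<and> Cinf_on g W \<and>
        (\<forall>x\<in>W. \<exists>v. frechet_derivative g (at x) v \<noteq> 0) \<and>
        \<Omega> \<inter> W = {x\<in>W. g x < 0})"

definition smooth_bounded_domain :: "'a::euclidean_space set \<Rightarrow> bool" where
  "smooth_bounded_domain \<Omega> \<longleftrightarrow>
     open \<Omega> \<and> connected \<Omega> \<and> \<Omega> \<noteq> {} \<and> bounded \<Omega> \<and> smooth_boundary \<Omega>"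

text \<open>A triple is ordered as \<open>(u\<^sub>1, u\<^sub>0, u\<^sub>-\<^sub>1)\<close>; the last component is written \<open>w\<close>.\<close>

type_synonym spinor = "real \<times> real \<times> real"

fun H_TF :: "real \<Rightarrow> real \<Rightarrow> spinor \<Rightarrow> real" where
  "H_TF \<alpha> q (u1, u0, w) =
     1 / 2 * (u1\<^sup>2 + u0\<^sup>2 + w\<^sup>2)\<^sup>2
     + \<alpha> / 2 * (2 * u0\<^sup>2 * (u1 - sgn \<alpha> * w)\<^sup>2 + (u1\<^sup>2 - w\<^sup>2)\<^sup>2)
     + q * (u1\<^sup>2 + w\<^sup>2)"

fun density :: "spinor \<Rightarrow> real" where
  "density (u1, u0, w) = u1\<^sup>2 + u0\<^sup>2 + w\<^sup>2"

fun magnetization :: "spinor \<Rightarrow> real" where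
  "magnetization (u1, u0, w) = u1\<^sup>2 - w\<^sup>2"

text \<open>Elements of \<open>L\<^sup>2\<close> are represented by functions on the whole space, of which only the
  restriction to \<open>\<Omega>\<close> up to null sets matters.\<close>

definition L2_nonneg :: "'a::euclidean_space set \<Rightarrow> ('a \<Rightarrow> real) \<Rightarrow> bool" where
  "L2_nonneg \<Omega> f \<longleftrightarrow> f \<in> borel_measurable (lebesgue_on \<Omega>) \<and>
     integrable (lebesgue_on \<Omega>) (\<lambda>x. (f x)\<^sup>2) \<and> (AE x in lebesgue_on \<Omega>. 0 \<le> f x)"

definition admissible :: "'a::euclidean_space set \<Rightarrow> real \<Rightarrow> real \<Rightarrow> ('a \<Rightarrow> spinor) \<Rightarrow> bool" where
  "admissible \<Omega> N M u \<longleftrightarrow>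
     L2_nonneg \<Omega> (\<lambda>x. fst (u x)) \<and>
     L2_nonneg \<Omega> (\<lambda>x. fst (snd (u x))) \<and>
     L2_nonneg \<Omega> (\<lambda>x. snd (snd (u x))) \<and>
     integral\<^sup>L (lebesgue_on \<Omega>) (\<lambda>x. density (u x)) = N \<and>
     integral\<^sup>L (lebesgue_on \<Omega>) (\<lambda>x. magnetization (u x)) = M"

text \<open>For \<open>u\<close> in \<open>L\<^sup>2\<close> the quartic integrand need not be integrable. The Bochner integral would
  then be \<open>0\<close>, so the energy is the extended-real integral, positive part minus negative part.
  For \<open>\<alpha> > - 1\<close> the integrand is bounded below by \<open>- \<bar>q\<bar> * density (u x)\<close>, so the
  negative part is finite and no \<open>\<infinity> - \<infinity>\<close> occurs on admissible \<open>u\<close>.\<close>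

definition energy ::
  "'a::euclidean_space set \<Rightarrow> real \<Rightarrow> real \<Rightarrow> ('a \<Rightarrow> spinor) \<Rightarrow> ereal" where
  "energy \<Omega> \<alpha> q u =
     enn2ereal (\<integral>\<^sup>+ x. ennreal (H_TF \<alpha> q (u x)) \<partial>lebesgue_on \<Omega>)
     - enn2ereal (\<integral>\<^sup>+ x. ennreal (- H_TF \<alpha> q (u x)) \<partial>lebesgue_on \<Omega>)"

definition global_minimizer ::
  "'a::euclidean_space set \<Rightarrow> real \<Rightarrow> real \<Rightarrow> real \<Rightarrow> real \<Rightarrow> ('a \<Rightarrow> spinor) \<Rightarrow> bool" where
  "global_minimizer \<Omega> \<alpha> q N M u \<longleftrightarrow> is_arg_min (energy \<Omega> \<alpha> q) (admissible \<Omega> N M) u"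

end

(* Since sgn alpha = -1, completing squares gives
     H_TF = (1+alpha)/2 (rho - n)^2 - alpha/2 (u_0^2 - 2 u_1 u_{-1})^2 - q u_0^2 + (affine function of rho),
   where rho is the density.  The integral of the affine part is fixed by the mass constraint,
   and for -1 < alpha < 0, q < 0 the remaining excess is nonnegative and vanishes, on nonnegative
   vectors, only at a and b.  Hence the minimizers are the admissible functions with values
   in {a, b}, and the magnetization constraint determines the measure of the set where u = a. *)

theory Submission
  imports Defs
begin

section \<open>Extended-real integrals\<close>

text \<open>This splits an integrable summand off the energy even when the rest has infinite
  integral. If \<open>g\<close> is integrable, all terms are Bochner integrals; otherwise both sides
  are infinite, because \<open>l\<close> can only produce a finite negative part.\<close>

lemma ereal_nn_integral_add_integrable:
  fixes g l :: "'a \<Rightarrow> real"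
  assumes g: "g \<in> borel_measurable P" "\<And>x. 0 \<le> g x" and l: "integrable P l"
  shows "enn2ereal (\<integral>\<^sup>+x. ennreal (g x + l x) \<partial>P) - enn2ereal (\<integral>\<^sup>+x. ennreal (- (g x + l x)) \<partial>P)
    = enn2ereal (\<integral>\<^sup>+x. ennreal (g x) \<partial>P) + ereal (integral\<^sup>L P l)"
proof (cases "(\<integral>\<^sup>+x. ennreal (g x) \<partial>P) = \<infinity>")
  case False
  then have ig: "integrable P g"
    using g by (intro integrableI_nonneg) (auto simp: top.not_eq_extremum)
  then have igl: "integrable P (\<lambda>x. g x + l x)"
    using l by simp
  obtain r s where rs: "0 \<le> r" "0 \<le> s" "(\<integral>\<^sup>+x. ennreal (g x + l x) \<partial>P) = ennreal r"
      "(\<integral>\<^sup>+x. ennreal (- (g x + l x)) \<partial>P) = ennreal s" "(\<integral>x. g x + l x \<partial>P) = r - s"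
    using igl by (rule integrableE)
  have "enn2ereal (\<integral>\<^sup>+x. ennreal (g x) \<partial>P) = ereal (integral\<^sup>L P g)"
    using nn_integral_eq_integral[OF ig] g by (simp add: enn2ereal_ennreal integral_nonneg_AE)
  then show ?thesis
    using rs ig l by (simp add: enn2ereal_ennreal)
next
  case True
  have lfin: "(\<integral>\<^sup>+x. ennreal \<bar>l x\<bar> \<partial>P) < \<infinity>"
    using l by (simp add: integrable_iff_bounded)
  have lm: "l \<in> borel_measurable P"
    using l by simp
  \<comment> \<open>\<open>ennreal\<close> truncates negative values to 0, so this bounds
    \<open>g\<close> by the positive part of \<open>g + l\<close> plus the absolute value of
    \<open>l\<close>; the positive part must then carry the infinite integral.\<close>
  have "(\<integral>\<^sup>+x. ennreal (g x) \<partial>P) \<le> (\<integral>\<^sup>+x. ennreal (g x + l x) + ennreal \<bar>l x\<bar> \<partial>P)"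
  proof (intro nn_integral_mono)
    fix x
    have "ennreal (g x) \<le> ennreal (max 0 (g x + l x) + \<bar>l x\<bar>)"
      by (intro ennreal_leI) auto
    also have "\<dots> = ennreal (g x + l x) + ennreal \<bar>l x\<bar>"
      by (subst ennreal_plus) (auto simp: max_def ennreal_neg)
    finally show "ennreal (g x) \<le> ennreal (g x + l x) + ennreal \<bar>l x\<bar>" .
  qed
  also have "\<dots> = (\<integral>\<^sup>+x. ennreal (g x + l x) \<partial>P) + (\<integral>\<^sup>+x. ennreal \<bar>l x\<bar> \<partial>P)"
    using g(1) lm by (intro nn_integral_add) auto
  finally have "(\<integral>\<^sup>+x. ennreal (g x + l x) \<partial>P) = \<infinity>"
    using True lfin by (auto simp: top_unique)
  moreover have "(\<integral>\<^sup>+x. ennreal (- (g x + l x)) \<partial>P) \<le> (\<integral>\<^sup>+x. ennreal \<bar>l x\<bar> \<partial>P)"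
    using g(2) by (intro nn_integral_mono ennreal_leI) (smt (verit))
  then have "(\<integral>\<^sup>+x. ennreal (- (g x + l x)) \<partial>P) < \<infinity>"
    using lfin by simp
  ultimately show ?thesis
    using True by (cases "(\<integral>\<^sup>+x. ennreal (- (g x + l x)) \<partial>P)")
      (auto simp: enn2ereal_ennreal)
qed

section \<open>Subsets of prescribed measure\<close>

lemma exists_lmeasurable_subset_measure_eq:
  fixes S :: "'a::euclidean_space set"
  assumes S: "bounded S" "S \<in> sets lebesgue" and t: "0 \<le> t" "t \<le> measure lebesgue S"
  obtains U where "U \<in> sets lebesgue" "U \<subseteq> S" "measure lebesgue U = t"
proof -
  txt \<open>Cut \<open>S\<close> by balls: the measure of the part inside varies continuously with the radius.\<close>
  obtain R where R: "S \<subseteq> cball 0 R"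
    using bounded_subset_ballD[OF S(1), of 0] ball_subset_cball by (meson order_trans)
  have Slm: "S \<in> lmeasurable"
    using S by (simp add: bounded_set_imp_lmeasurable)
  \<comment> \<open>The truncation \<open>max 0 r\<close> makes \<open>f\<close> and
    \<open>V\<close> meaningful on the whole line, so continuity can be treated on
    \<open>UNIV\<close>.\<close>
  define f where "f r = measure lebesgue (S \<inter> cball 0 (max 0 r))" for r
  define V where "V = (\<lambda>r::real. measure lebesgue (cball (0::'a) (max 0 r)))"
  have contV: "continuous_on UNIV V"
    unfolding V_def by (simp add: content_cball) (intro continuous_intros)
  \<comment> \<open>Between two radii \<open>f\<close> changes by the measure of \<open>S\<close>
    within a shell, \<open>V\<close> by that of the whole shell. Hence \<open>f\<close> inherits the
    continuity of \<open>V\<close>, which is explicit.\<close>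
  have lip: "\<bar>f r - f s\<bar> \<le> \<bar>V r - V s\<bar>" for r s
  proof -
    have *: "f s \<le> f r \<and> f r - f s \<le> V r - V s" if "s \<le> r" for r s
    proof -
      let ?A = "cball (0::'a) (max 0 r)" and ?B = "cball (0::'a) (max 0 s)"
      have BA: "?B \<subseteq> ?A" using that by auto
      have SA: "S \<inter> ?A \<in> lmeasurable" and SB: "S \<inter> ?B \<in> lmeasurable"
        using Slm by (auto intro: fmeasurable.Int)
      have "f r - f s = measure lebesgue (S \<inter> ?A - S \<inter> ?B)"
        unfolding f_def using BA by (subst measurable_measure_Diff[OF SA]) (use SB in auto)
      also have "\<dots> \<le> measure lebesgue (?A - ?B)"
        using SA SB by (intro measure_mono_fmeasurable) auto
      also have "\<dots> = V r - V s"
        unfolding V_def using BA by (subst measurable_measure_Diff) auto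
      finally have "f r - f s \<le> V r - V s" .
      moreover have "f s \<le> f r"
        unfolding f_def using BA SA SB by (intro measure_mono_fmeasurable) auto
      ultimately show ?thesis by simp
    qed
    show ?thesis
      using *[of r s] *[of s r] by linarith
  qed
  have "continuous_on UNIV f"
    unfolding continuous_on_iff
  proof (intro ballI allI impI)
    fix r e :: real assume "0 < e"
    then obtain d where "0 < d" "\<And>s. dist s r < d \<Longrightarrow> dist (V s) (V r) < e"
      using contV unfolding continuous_on_iff by blast
    then show "\<exists>d>0. \<forall>s\<in>UNIV. dist s r < d \<longrightarrow> dist (f s) (f r) < e"
      using lip unfolding dist_real_def by (meson le_less_trans)
  qed
  then have cont: "continuous_on {0..max 0 R} f"
    by (rule continuous_on_subset) simp
  \<comment> \<open>The ball of radius 0 is a single point, so the intermediate value argument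
    starts at measure 0.\<close>
  have "f 0 \<le> measure lebesgue {0::'a}"
    unfolding f_def using S(2)
    by (intro measure_mono_fmeasurable) (auto intro: bounded_set_imp_lmeasurable)
  then have "f 0 \<le> t"
    using t by simp
  moreover have "S \<inter> cball 0 (max 0 R) = S"
    using R by auto
  then have "t \<le> f (max 0 R)"
    using t by (simp add: f_def)
  ultimately obtain r where "f r = t"
    using IVT'[of f 0 t "max 0 R"] cont by auto
  then show thesis
    using S by (intro that[of "S \<inter> cball 0 (max 0 r)"]) (auto simp: f_def)
qed

section \<open>Pointwise analysis of the Hamiltonian\<close>

definition excess :: "real \<Rightarrow> real \<Rightarrow> real \<Rightarrow> spinor \<Rightarrow> real" where
  "excess \<alpha> q n v = (1 + \<alpha>) / 2 * (density v - n)\<^sup>2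
    + - \<alpha> / 2 * ((fst (snd v))\<^sup>2 - 2 * fst v * snd (snd v))\<^sup>2 + - q * (fst (snd v))\<^sup>2"

text \<open>With sgn \<alpha> = -1 the bracket in \<open>H_TF\<close> equals
  \<open>(density v)\<^sup>2\<close> minus the square of \<open>u0\<^sup>2 - 2 * u1 * w\<close>, and
  the linear term is \<open>q * (density v - u0\<^sup>2)\<close>. The affine remainder comes from
  expanding the squared density about \<open>n\<close>.\<close>

lemma H_TF_eq_excess:
  assumes "\<alpha> < 0"
  shows "H_TF \<alpha> q v = excess \<alpha> q n v + (((1 + \<alpha>) * n + q) * density v - (1 + \<alpha>) / 2 * n\<^sup>2)"
  using assms by (cases v) (simp add: excess_def power2_eq_square field_simps)

lemma excess_nonneg:
  assumes "- 1 < \<alpha>" "\<alpha> < 0" "q < 0"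
  shows "0 \<le> excess \<alpha> q n v"
  using assms unfolding excess_def by (intro add_nonneg_nonneg mult_nonneg_nonneg) auto

text \<open>All three terms must vanish, and their coefficients are nonzero. So
  \<open>u0 = 0\<close>, then \<open>u1 * w = 0\<close>, and the density condition with the signs
  fixes the remaining component.\<close>

lemma excess_eq_0D:
  assumes par: "- 1 < \<alpha>" "\<alpha> < 0" "q < 0" and z: "excess \<alpha> q n (u1, u0, w) = 0"
    and nonneg: "0 \<le> u1" "0 \<le> w"
  shows "(u1, u0, w) = (sqrt n, 0, 0) \<or> (u1, u0, w) = (0, 0, sqrt n)"
proof -
  have nn: "0 \<le> (1 + \<alpha>) / 2 * (density (u1, u0, w) - n)\<^sup>2"
      "0 \<le> - \<alpha> / 2 * (u0\<^sup>2 - 2 * u1 * w)\<^sup>2" "0 \<le> - q * u0\<^sup>2"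
    using par by (auto intro!: mult_nonneg_nonneg mult_nonpos_nonneg)
  have "(1 + \<alpha>) / 2 * (density (u1, u0, w) - n)\<^sup>2 = 0" "- \<alpha> / 2 * (u0\<^sup>2 - 2 * u1 * w)\<^sup>2 = 0"
      "- q * u0\<^sup>2 = 0"
    using nn z unfolding excess_def fst_conv snd_conv by linarith+
  then have "density (u1, u0, w) = n" "u0\<^sup>2 = 2 * u1 * w" "u0 = 0"
    using par by auto
  then show ?thesis
    using nonneg by auto
qed

lemma excess_eq_0I:
  assumes "0 \<le> n"
  shows "excess \<alpha> q n (sqrt n, 0, 0) = 0" "excess \<alpha> q n (0, 0, sqrt n) = 0"
  using assms by (simp_all add: excess_def)

lemma density_eq: "density v = (fst v)\<^sup>2 + (fst (snd v))\<^sup>2 + (snd (snd v))\<^sup>2"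
  by (cases v) simp

lemma magnetization_eq: "magnetization v = (fst v)\<^sup>2 - (snd (snd v))\<^sup>2"
  by (cases v) simp

text \<open>The affine part integrates to a constant determined by \<open>N\<close> and the measure
  of the domain, the same for every admissible function. Minimizing the energy thus means minimizing
  the integral of \<open>excess\<close>.\<close>

lemma energy_eq_excess:
  assumes \<Omega>: "\<Omega> \<in> lmeasurable" and par: "- 1 < \<alpha>" "\<alpha> < 0" "q < 0" and u: "admissible \<Omega> N M u"
  shows "energy \<Omega> \<alpha> q u = enn2ereal (\<integral>\<^sup>+x. ennreal (excess \<alpha> q n (u x)) \<partial>lebesgue_on \<Omega>)
      + ereal (((1 + \<alpha>) * n + q) * N - (1 + \<alpha>) / 2 * n\<^sup>2 * measure lebesgue \<Omega>)"
    and "(\<lambda>x. excess \<alpha> q n (u x)) \<in> borel_measurable (lebesgue_on \<Omega>)"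
proof -
  interpret finite_measure "lebesgue_on \<Omega>"
    using \<Omega> by (rule finite_measure_lebesgue_on)
  have m: "(\<lambda>x. fst (u x)) \<in> borel_measurable (lebesgue_on \<Omega>)"
      "(\<lambda>x. fst (snd (u x))) \<in> borel_measurable (lebesgue_on \<Omega>)"
      "(\<lambda>x. snd (snd (u x))) \<in> borel_measurable (lebesgue_on \<Omega>)"
    and i: "integrable (lebesgue_on \<Omega>) (\<lambda>x. density (u x))"
    using u by (auto simp: admissible_def L2_nonneg_def density_eq)
  show em: "(\<lambda>x. excess \<alpha> q n (u x)) \<in> borel_measurable (lebesgue_on \<Omega>)"
    unfolding excess_def density_eq using m by measurable
  let ?l = "\<lambda>x. ((1 + \<alpha>) * n + q) * density (u x) - (1 + \<alpha>) / 2 * n\<^sup>2"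
  have il: "integrable (lebesgue_on \<Omega>) ?l"
    using i by simp
  have "integral\<^sup>L (lebesgue_on \<Omega>) ?l
      = ((1 + \<alpha>) * n + q) * N - (1 + \<alpha>) / 2 * n\<^sup>2 * measure lebesgue \<Omega>"
    using i u \<Omega> by (simp add: admissible_def measure_restrict_space)
  then show "energy \<Omega> \<alpha> q u = enn2ereal (\<integral>\<^sup>+x. ennreal (excess \<alpha> q n (u x)) \<partial>lebesgue_on \<Omega>)
      + ereal (((1 + \<alpha>) * n + q) * N - (1 + \<alpha>) / 2 * n\<^sup>2 * measure lebesgue \<Omega>)"
    using ereal_nn_integral_add_integrable[OF em excess_nonneg[OF par] il]
    unfolding energy_def H_TF_eq_excess[OF par(2), of q _ n] by simp
qed

section \<open>Two-valued functions\<close>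

lemma integral_two_valued:
  fixes c d :: real
  assumes \<Omega>: "\<Omega> \<in> lmeasurable" and U: "U \<in> sets lebesgue" "U \<subseteq> \<Omega>"
  shows "integrable (lebesgue_on \<Omega>) (\<lambda>x. if x \<in> U then c else d)"
    and "integral\<^sup>L (lebesgue_on \<Omega>) (\<lambda>x. if x \<in> U then c else d)
      = c * measure lebesgue U + d * (measure lebesgue \<Omega> - measure lebesgue U)"
proof -
  interpret finite_measure "lebesgue_on \<Omega>"
    using \<Omega> by (rule finite_measure_lebesgue_on)
  have Us: "U \<in> sets (lebesgue_on \<Omega>)"
    using U \<Omega> by (simp add: sets_restrict_space_iff)
  have eq: "(\<lambda>x. if x \<in> U then c else d) = (\<lambda>x. (c - d) * indicator U x + d)"
    by auto
  have iU: "integrable (lebesgue_on \<Omega>) (indicator U :: _ \<Rightarrow> real)"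
    using Us by (intro integrable_real_indicator) (simp_all add: top.not_eq_extremum[symmetric])
  then show "integrable (lebesgue_on \<Omega>) (\<lambda>x. if x \<in> U then c else d)"
    unfolding eq by simp
  have "integral\<^sup>L (lebesgue_on \<Omega>) (indicator U :: _ \<Rightarrow> real) = measure lebesgue U"
    using U \<Omega> Us by (simp add: measure_restrict_space Int_absorb2 inf.absorb1)
  then show "integral\<^sup>L (lebesgue_on \<Omega>) (\<lambda>x. if x \<in> U then c else d)
      = c * measure lebesgue U + d * (measure lebesgue \<Omega> - measure lebesgue U)"
    unfolding eq using iU \<Omega> by (simp add: measure_restrict_space algebra_simps)
qed

text \<open>Both phases have density \<open>n\<close>, while the magnetization is \<open>n\<close>
  on \<open>U\<close> and \<open>- n\<close> elsewhere; the last two assumptions are the constraints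
  evaluated accordingly.\<close>

lemma admissible_two_phase:
  assumes \<Omega>: "\<Omega> \<in> lmeasurable" and U: "U \<in> sets lebesgue" "U \<subseteq> \<Omega>" and n: "0 \<le> n"
    and N: "n * measure lebesgue \<Omega> = N" and M: "n * (2 * measure lebesgue U - measure lebesgue \<Omega>) = M"
  shows "admissible \<Omega> N M (\<lambda>x. if x \<in> U then (sqrt n, 0, 0) else (0, 0, sqrt n))"
proof -
  let ?v = "\<lambda>x. if x \<in> U then (sqrt n, 0, 0) else (0, 0, sqrt n)"
  have L2: "L2_nonneg \<Omega> (\<lambda>x. if x \<in> U then c else d)" if "0 \<le> c" "0 \<le> d" for c d
    using integral_two_valued(1)[OF \<Omega> U] that by (auto simp: L2_nonneg_def if_distrib[of power2])
  \<comment> \<open>Even the constant entries are written as conditionals, so that the integral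
    formula for two-valued functions rewrites all of them.\<close>
  have comp: "fst (?v x) = (if x \<in> U then sqrt n else 0)" "fst (snd (?v x)) = (if x \<in> U then 0 else 0)"
      "snd (snd (?v x)) = (if x \<in> U then 0 else sqrt n)"
      "density (?v x) = (if x \<in> U then n else n)" "magnetization (?v x) = (if x \<in> U then n else - n)" for x
    using n by auto
  show ?thesis
    unfolding admissible_def comp integral_two_valued(2)[OF \<Omega> U]
    using L2[of 0 0] L2 n N M by (simp add: algebra_simps)
qed

section \<open>Existence and form of the minimizers\<close>

theorem theorem3p4:
  fixes \<Omega> :: "(real^3) set" and \<alpha> q N M n m :: real and a b :: spinor
  assumes "smooth_bounded_domain \<Omega>"
    and "N > 0" and "0 \<le> M" and "M \<le> N"
    and "n = N / measure lebesgue \<Omega>" and "m = M / measure lebesgue \<Omega>"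
    and "- 1 < \<alpha>" and "\<alpha> < 0" and "m \<ge> 0" and "q < 0"
    and "a = (sqrt n, 0, 0)" and "b = (0, 0, sqrt n)"
  shows "(\<exists>u. global_minimizer \<Omega> \<alpha> q N M u) \<and>
    (\<forall>u. global_minimizer \<Omega> \<alpha> q N M u \<longrightarrow>
      (\<exists>U. U \<in> sets lebesgue \<and> U \<subseteq> \<Omega> \<and>
         measure lebesgue U = 1 / 2 * (1 + m / n) * measure lebesgue \<Omega> \<and>
         (AE x in lebesgue_on \<Omega>.
            u x = indicator U x *\<^sub>R a + indicator (\<Omega> - U) x *\<^sub>R b)))"
proof -
  have dom: "open \<Omega>" "\<Omega> \<noteq> {}" "bounded \<Omega>"
    using assms(1) by (auto simp: smooth_bounded_domain_def)
  have \<Omega>: "\<Omega> \<in> lmeasurable"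
    using dom by (simp add: lmeasurable_open)
  have pos: "0 < measure lebesgue \<Omega>"
    using dom \<Omega> by (metis measure_nonneg negligible_iff_measure0 open_not_negligible order_le_less)
  have n: "0 < n" "n * measure lebesgue \<Omega> = N" and m: "m / n = M / N"
    using assms(2,5,6) pos by auto
  note par = \<open>- 1 < \<alpha>\<close> \<open>\<alpha> < 0\<close> \<open>q < 0\<close>
  note energy = energy_eq_excess[OF \<Omega> par, where N = N and M = M and n = n]
  define t where "t = 1 / 2 * (1 + m / n) * measure lebesgue \<Omega>"
  have "M = m * measure lebesgue \<Omega>"
    using assms(6) pos by simp
  then have "n * (2 * s - measure lebesgue \<Omega>) - M = 2 * n * (s - t)" for s
    unfolding t_def using n(1) by (simp add: field_simps)
  \<comment> \<open>The left side is the total magnetization when the phase \<open>a\<close>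
    occupies measure \<open>s\<close>. One direction makes the candidate admissible, the other
    determines the phase measure of an arbitrary minimizer.\<close>
  then have Mt: "n * (2 * s - measure lebesgue \<Omega>) = M \<longleftrightarrow> s = t" for s
    using n(1) by (smt (verit) mult_eq_0_iff)
  have "0 \<le> t" "t \<le> measure lebesgue \<Omega>"
    using assms(2,3,4) pos unfolding t_def m by (auto simp: field_simps)
  then obtain U where U: "U \<in> sets lebesgue" "U \<subseteq> \<Omega>" "measure lebesgue U = t"
    using exists_lmeasurable_subset_measure_eq[OF dom(3)] \<Omega> by blast
  define v where "v = (\<lambda>x. if x \<in> U then a else b)"
  have v: "admissible \<Omega> N M v"
    unfolding v_def assms(11,12) using n U Mt by (intro admissible_two_phase \<Omega>) auto
  have "excess \<alpha> q n (v x) = 0" for x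
    using excess_eq_0I[of n] n by (simp add: v_def assms(11,12))
  then have Ev: "energy \<Omega> \<alpha> q v
      = ereal (((1 + \<alpha>) * n + q) * N - (1 + \<alpha>) / 2 * n\<^sup>2 * measure lebesgue \<Omega>)"
    using energy(1)[OF v] by (simp add: zero_ennreal.rep_eq)
  \<comment> \<open>The energy of \<open>v\<close> is the common constant alone; any other
    admissible function adds a nonnegative integral.\<close>
  have "energy \<Omega> \<alpha> q v \<le> energy \<Omega> \<alpha> q u" if "admissible \<Omega> N M u" for u
    unfolding Ev energy(1)[OF that] by (simp add: ereal_le_add_self2)
  then have min: "global_minimizer \<Omega> \<alpha> q N M v"
    using v by (auto simp: global_minimizer_def is_arg_min_def not_less)
  have "\<exists>U. U \<in> sets lebesgue \<and> U \<subseteq> \<Omega> \<and> measure lebesgue U = t \<and>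
      (AE x in lebesgue_on \<Omega>. u x = indicator U x *\<^sub>R a + indicator (\<Omega> - U) x *\<^sub>R b)"
    if "global_minimizer \<Omega> \<alpha> q N M u" for u
  proof -
    have u: "admissible \<Omega> N M u" and le: "energy \<Omega> \<alpha> q u \<le> energy \<Omega> \<alpha> q v"
      using that v by (auto simp: global_minimizer_def is_arg_min_def not_less)
    \<comment> \<open>Comparison with \<open>v\<close> cancels the finite constant and leaves a
      nonnegative integral that is at most 0; an infinite value is excluded as well.\<close>
    have "(\<integral>\<^sup>+x. ennreal (excess \<alpha> q n (u x)) \<partial>lebesgue_on \<Omega>) = 0"
      using le unfolding Ev energy(1)[OF u]
      by (cases "\<integral>\<^sup>+x. ennreal (excess \<alpha> q n (u x)) \<partial>lebesgue_on \<Omega>") (auto simp: enn2ereal_ennreal)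
    then have "AE x in lebesgue_on \<Omega>. ennreal (excess \<alpha> q n (u x)) = 0"
      using energy(2)[OF u] by (subst (asm) nn_integral_0_iff_AE) auto
    moreover have "AE x in lebesgue_on \<Omega>. 0 \<le> fst (u x)" "AE x in lebesgue_on \<Omega>. 0 \<le> snd (snd (u x))"
      using u by (auto simp: admissible_def L2_nonneg_def)
    ultimately have ab: "AE x in lebesgue_on \<Omega>. u x = a \<or> u x = b"
    proof eventually_elim
      case (elim x)
      \<comment> \<open>A vanishing \<open>ennreal\<close> only says that the excess is at most 0;
        its nonnegativity gives equality.\<close>
      then have "excess \<alpha> q n (u x) = 0"
        using excess_nonneg[OF par, of n "u x"] by (simp add: ennreal_eq_0_iff)
      then show ?case
        using excess_eq_0D[OF par, of n "fst (u x)" "fst (snd (u x))" "snd (snd (u x))"] elim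
        by (simp add: assms(11,12))
    qed
    \<comment> \<open>Since \<open>n > 0\<close>, the first component alone separates
      \<open>a\<close> from \<open>b\<close>, and its measurability makes \<open>W\<close>
      measurable.\<close>
    define W where "W = {x \<in> \<Omega>. fst (u x) = sqrt n}"
    have um: "(\<lambda>x. fst (u x)) \<in> borel_measurable (lebesgue_on \<Omega>)"
        "(\<lambda>x. snd (snd (u x))) \<in> borel_measurable (lebesgue_on \<Omega>)"
      using u by (auto simp: admissible_def L2_nonneg_def)
    have "{x \<in> space (lebesgue_on \<Omega>). fst (u x) = sqrt n} \<in> sets (lebesgue_on \<Omega>)"
      using um by measurable
    then have W: "W \<in> sets lebesgue" "W \<subseteq> \<Omega>"
      using \<Omega> by (auto simp: W_def sets_restrict_space_iff)
    have "AE x in lebesgue_on \<Omega>. x \<in> \<Omega>"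
      using AE_space[of "lebesgue_on \<Omega>"] by simp
    with ab have form: "AE x in lebesgue_on \<Omega>. u x = (if x \<in> W then a else b)"
      by eventually_elim (use n in \<open>auto simp: W_def assms(11,12)\<close>)
    \<comment> \<open>The magnetization constraint, evaluated on the two-phase form, fixes the
      measure of \<open>W\<close> through \<open>Mt\<close>.\<close>
    have "M = integral\<^sup>L (lebesgue_on \<Omega>) (\<lambda>x. magnetization (u x))"
      using u by (simp add: admissible_def)
    also have "\<dots> = integral\<^sup>L (lebesgue_on \<Omega>) (\<lambda>x. if x \<in> W then n else - n)"
    proof (rule integral_cong_AE)
      show "(\<lambda>x. magnetization (u x)) \<in> borel_measurable (lebesgue_on \<Omega>)"
        unfolding magnetization_eq using um by measurable
      show "(\<lambda>x. if x \<in> W then n else - n) \<in> borel_measurable (lebesgue_on \<Omega>)"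
        using integral_two_valued(1)[OF \<Omega> W] by auto
      show "AE x in lebesgue_on \<Omega>. magnetization (u x) = (if x \<in> W then n else - n)"
        using form by eventually_elim (use n in \<open>simp add: assms(11,12)\<close>)
    qed
    finally have "measure lebesgue W = t"
      unfolding integral_two_valued(2)[OF \<Omega> W] Mt[symmetric] by (simp add: algebra_simps)
    moreover have "AE x in lebesgue_on \<Omega>. u x = indicator W x *\<^sub>R a + indicator (\<Omega> - W) x *\<^sub>R b"
      using form \<open>AE x in lebesgue_on \<Omega>. x \<in> \<Omega>\<close> by eventually_elim auto
    ultimately show ?thesis
      using W by blast
  qed
  then show ?thesis
    using min unfolding t_def by blast
qed

end
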